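(* Let $L\ge 2$, let $\kappa=(\kappa_1,\ldots,\kappa_L)$ be any sequence of positive integers, and put $n=\kappa_1+\cdots+\kappa_L$ and $\kappa_{\min}=\min\{\kappa_1,\ldots,\kappa_L\}$. Let $\iota(\kappa)$ be the largest constant such that $$\frac{|\partial A|}{|A|}\ \ge\ \iota(\kappa)\,\log\left(\frac{|\Omega_\kappa|}{|A|}\right)\qquad\text{for all non-empty }A\subseteq\Omega_\kappa .$$ Then $$\frac{\log 2}{4}\,\frac{n}{\log\left(\frac{n}{\kappa_{\min}}\right)}\ \le\ \iota(\kappa)\ \le\ \frac{n}{\log\left(\frac{n}{\kappa_{\min}}\right)}.$$
   Context: All logarithms are natural. For $\kappa=(\kappa_1,\ldots,\kappa_L)$ with $n=\sum_\ell\kappa_\ell$, the multislice is $\Omega_\kappa=\{\omega\in\{1,\ldots,L\}^n:\ \#\{i:\omega_i=\ell\}=\kappa_\ell\text{ for each }\ell\}$. It is given the structure of a simple graph by declaring $\omega,\omega'\in\Omega_\kappa$ adjacent if and only if they differ at exactly two coordinates. For $A\subseteq\Omega_\kappa$, $\partial A$ denotes the edge boundary of $A$, i.e. the set of edges having one endpoint in $A$ and the other outside $A$. *)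

theory Defs
  imports Complex_Main "HOL-Library.FuncSet"
begin

text \<open>Points are extensional functions, so that two of them are equal iff they agree on the
  coordinates \<open>1, \<dots>, n\<close>, where \<open>n = \<kappa> 1 + \<dots> + \<kappa> L\<close>. Only the values \<open>\<kappa> 1, \<dots>, \<kappa> L\<close> matter.\<close>

definition multislice :: "nat \<Rightarrow> (nat \<Rightarrow> nat) \<Rightarrow> (nat \<Rightarrow> nat) set" where
  "multislice L \<kappa> =
     {\<omega> \<in> {1..(\<Sum>l=1..L. \<kappa> l)} \<rightarrow>\<^sub>E {1..L}.
        \<forall>l\<in>{1..L}. card {i \<in> {1..(\<Sum>l=1..L. \<kappa> l)}. \<omega> i = l} = \<kappa> l}"

definition multislice_edges :: "nat \<Rightarrow> (nat \<Rightarrow> nat) \<Rightarrow> (nat \<Rightarrow> nat) set set" where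
  "multislice_edges L \<kappa> =
     {{\<omega>, \<omega>'} | \<omega> \<omega>'. \<omega> \<in> multislice L \<kappa> \<and> \<omega>' \<in> multislice L \<kappa> \<and>
        card {i \<in> {1..(\<Sum>l=1..L. \<kappa> l)}. \<omega> i \<noteq> \<omega>' i} = 2}"

definition edge_boundary :: "'a set set \<Rightarrow> 'a set \<Rightarrow> 'a set set" where
  "edge_boundary E A = {e \<in> E. \<exists>x y. e = {x, y} \<and> x \<in> A \<and> y \<notin> A}"

definition log_isoperimetric_bound :: "nat \<Rightarrow> (nat \<Rightarrow> nat) \<Rightarrow> real \<Rightarrow> bool" where
  "log_isoperimetric_bound L \<kappa> c \<longleftrightarrow>
     (\<forall>A. A \<subseteq> multislice L \<kappa> \<and> A \<noteq> {} \<longrightarrow>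
        real (card (edge_boundary (multislice_edges L \<kappa>) A)) / real (card A)
          \<ge> c * ln (real (card (multislice L \<kappa>)) / real (card A)))"

definition iota :: "nat \<Rightarrow> (nat \<Rightarrow> nat) \<Rightarrow> real" where
  "iota L \<kappa> = (GREATEST c. log_isoperimetric_bound L \<kappa> c)"

text \<open>The maximum defining \<^const>\<open>iota\<close> is attained as soon as the multislice has two points.\<close>

lemma finite_multislice: "finite (multislice L \<kappa>)"
proof -
  have "finite ({1..(\<Sum>l=1..L. \<kappa> l)} \<rightarrow>\<^sub>E {1..L})" by (intro finite_PiE) auto
  then show ?thesis unfolding multislice_def by simp
qed

lemma log_isoperimetric_bound_iota:
  assumes "card (multislice L \<kappa>) \<ge> 2"
  shows "log_isoperimetric_bound L \<kappa> (iota L \<kappa>)"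
    and "\<And>c. log_isoperimetric_bound L \<kappa> c \<Longrightarrow> c \<le> iota L \<kappa>"
proof -
  define V where "V = multislice L \<kappa>"
  define b where "b A = real (card (edge_boundary (multislice_edges L \<kappa>) A)) / real (card A)" for A
  define h where "h A = ln (real (card V) / real (card A))" for A :: "(nat \<Rightarrow> nat) set"
  define F where "F = {A. A \<subset> V \<and> A \<noteq> {}}"
  define m where "m = Min ((\<lambda>A. b A / h A) ` F)"
  have finV: "finite V" unfolding V_def by (rule finite_multislice)
  have finF: "finite F"
    by (rule finite_subset[of _ "Pow V"]) (use finV in \<open>auto simp: F_def\<close>)
  have hpos: "h A > 0" if "A \<in> F" for A
  proof -
    have "card A < card V" "card A > 0"
      using that finV psubset_card_mono[of V A] finite_subset[of A V]
      by (auto simp: F_def card_gt_0_iff)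
    then show ?thesis by (simp add: h_def)
  qed
  obtain v where "v \<in> V" using assms unfolding V_def by fastforce
  moreover have "{v} \<noteq> V" using assms unfolding V_def by (metis One_nat_def Suc_1 card_1_singleton_iff not_less_eq_eq order_refl)
  ultimately have Fne: "F \<noteq> {}" by (auto simp: F_def)
  have bnd: "log_isoperimetric_bound L \<kappa> c \<longleftrightarrow> (\<forall>A\<in>F. c \<le> b A / h A)" for c
  proof -
    have "log_isoperimetric_bound L \<kappa> c \<longleftrightarrow> (\<forall>A. A \<subseteq> V \<and> A \<noteq> {} \<longrightarrow> c * h A \<le> b A)"
      unfolding log_isoperimetric_bound_def b_def h_def V_def ..
    also have "\<dots> \<longleftrightarrow> (\<forall>A\<in>F. c * h A \<le> b A)"
    proof -
      have "c * h V \<le> b V" by (simp add: h_def b_def)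
      then show ?thesis unfolding F_def by (auto simp: psubset_eq)
    qed
    also have "\<dots> \<longleftrightarrow> (\<forall>A\<in>F. c \<le> b A / h A)"
      using hpos by (auto simp: pos_le_divide_eq)
    finally show ?thesis .
  qed
  have Pm: "log_isoperimetric_bound L \<kappa> m"
    unfolding bnd m_def using finF by auto
  have mx: "c \<le> m" if "log_isoperimetric_bound L \<kappa> c" for c
    using that finF Fne unfolding bnd m_def by (auto simp: Min_ge_iff)
  have "iota L \<kappa> = m"
    unfolding iota_def by (rule Greatest_equality) (use Pm mx in auto)
  then show "log_isoperimetric_bound L \<kappa> (iota L \<kappa>)"
    and "\<And>c. log_isoperimetric_bound L \<kappa> c \<Longrightarrow> c \<le> iota L \<kappa>"
    using Pm mx by auto
qed

end

theory Submission
  imports Defs "HOL-Combinatorics.Transposition"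
begin

text \<open>Lower bound: \<open>ln (|\<Omega>| / |A|)\<close> is the relative entropy of the uniform distribution on
  \<open>A\<close> with respect to the one on \<open>\<Omega>\<close>. Condition on one coordinate
  \<open>i\<close> and average the chain rule over \<open>i\<close>. The conditional entropies are handled by induction on
  \<open>n\<close>. For the entropies of the one-coordinate marginals \<open>p\<^sub>i(l)\<close>, whose average over \<open>i\<close> is
  \<open>\<pi>\<^sub>l = \<kappa>\<^sub>l / n\<close>, convexity of \<open>p \<mapsto> p ln (p / \<pi>\<^sub>l)\<close> on \<open>[0, 1]\<close> gives a bound linear in
  \<open>(p\<^sub>i(l) - \<pi>\<^sub>l)\<^sup>+\<close>, and \<open>p\<^sub>i(l) - p\<^sub>j(l)\<close> is at most the fraction of \<open>x \<in> A\<close> with \<open>x\<^sub>i = l\<close>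
  that leave \<open>A\<close> when the coordinates \<open>i\<close> and \<open>j\<close> are swapped. The weight \<open>1 + ln (n / \<kappa>\<^sub>l)\<close>
  given to such a swap reproduces itself in the induction. Finally
  \<open>2 (1 + ln y) \<le> (4 / ln 2) ln y\<close> for \<open>y = n / \<kappa>_min \<ge> 2\<close>.

  Upper bound: test with \<open>A = {x. x\<^sub>1 = m}\<close> for a rarest colour \<open>m\<close>.\<close>

section \<open>Rearrangements of a function on a finite set\<close>

text \<open>Pinning the values outside \<open>S\<close>, rather than leaving them undefined there, makes the subset
  with a prescribed \<open>i\<close>-th coordinate again a set of rearrangements, on \<open>S - {i}\<close>.\<close>

definition rearrangements :: "'a set \<Rightarrow> ('a \<Rightarrow> 'b) \<Rightarrow> ('a \<Rightarrow> 'b) set" where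
  "rearrangements S u = {x. (\<forall>i. i \<notin> S \<longrightarrow> x i = u i) \<and>
     (\<forall>l. card {i \<in> S. x i = l} = card {i \<in> S. u i = l})}"

lemma rearrangements_refl: "u \<in> rearrangements S u"
  by (simp add: rearrangements_def)

lemma rearrangements_outside: "x \<in> rearrangements S u \<Longrightarrow> i \<notin> S \<Longrightarrow> x i = u i"
  by (simp add: rearrangements_def)

lemma rearrangements_card:
  "x \<in> rearrangements S u \<Longrightarrow> card {i \<in> S. x i = l} = card {i \<in> S. u i = l}"
  by (simp add: rearrangements_def)

lemma rearrangements_image:
  assumes "finite S" "x \<in> rearrangements S u" "i \<in> S"
  shows "x i \<in> u ` S"
proof (rule ccontr)
  assume "x i \<notin> u ` S"
  then have "{k \<in> S. u k = x i} = {}" by force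
  then have "card {k \<in> S. x k = x i} = 0"
    unfolding rearrangements_card[OF assms(2)] by (simp only: card.empty)
  then show False using assms by auto
qed

lemma finite_rearrangements:
  assumes "finite S"
  shows "finite (rearrangements S u)"
proof (rule finite_subset)
  show "rearrangements S u \<subseteq> (\<lambda>g i. if i \<in> S then g i else u i) ` (S \<rightarrow>\<^sub>E u ` S)"
  proof
    fix x assume x: "x \<in> rearrangements S u"
    have "x = (\<lambda>i. if i \<in> S then restrict x S i else u i)"
      using rearrangements_outside[OF x] by auto
    moreover have "restrict x S \<in> S \<rightarrow>\<^sub>E u ` S"
      using rearrangements_image[OF assms x] by auto
    ultimately show "x \<in> (\<lambda>g i. if i \<in> S then g i else u i) ` (S \<rightarrow>\<^sub>E u ` S)" by blast
  qed
  show "finite ((\<lambda>g i. if i \<in> S then g i else u i) ` (S \<rightarrow>\<^sub>E u ` S))"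
    using assms by (intro finite_imageI finite_PiE) auto
qed

lemma comp_transpose_in_rearrangements:
  assumes "x \<in> rearrangements S u" "i \<in> S" "j \<in> S"
  shows "x \<circ> transpose i j \<in> rearrangements S u"
proof -
  have "card {k \<in> S. (x \<circ> transpose i j) k = l} = card {k \<in> S. x k = l}" for l
    by (rule bij_betw_same_card[where f = "transpose i j"],
        rule bij_betw_byWitness[where f' = "transpose i j"])
       (use assms in \<open>auto simp: transpose_def\<close>)
  then show ?thesis
    using assms by (auto simp: rearrangements_def transpose_def)
qed

lemma comp_transpose_twice [simp]: "x \<circ> transpose i j \<circ> transpose i j = x"
  by (simp add: comp_assoc)

text \<open>Counts over \<open>S\<close> and over \<open>S - {i}\<close> differ by the indicator of
  the value at \<open>i\<close>, which is the same for \<open>x\<close> and \<open>v\<close> once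
  they agree there. Changing the base point from \<open>u\<close> to \<open>v\<close> pins
  coordinate \<open>i\<close> at the conditioned value, so the entropy induction can be applied to
  each fibre.\<close>

lemma rearrangements_fix_coordinate:
  assumes "finite S" "i \<in> S" "v \<in> rearrangements S u"
  shows "{x \<in> rearrangements S u. x i = v i} = rearrangements (S - {i}) v"
proof -
  have split: "card {k \<in> S. x k = l} = card {k \<in> S - {i}. x k = l} + of_bool (x i = l)"
    for x and l
  proof -
    have "{k \<in> S. x k = l} =
        (if x i = l then insert i {k \<in> S - {i}. x k = l} else {k \<in> S - {i}. x k = l})"
      using assms(2) by auto
    then show ?thesis using assms(1) by simp
  qed
  have u: "card {k \<in> S. u k = l} = card {k \<in> S. v k = l}" for l
    using rearrangements_card[OF assms(3)] by simp
  show ?thesis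
  proof (intro equalityI subsetI)
    fix x assume x: "x \<in> {x \<in> rearrangements S u. x i = v i}"
    have "card {k \<in> S. x k = l} = card {k \<in> S. v k = l}" for l
      using x u by (auto simp: rearrangements_def)
    then have "card {k \<in> S - {i}. x k = l} = card {k \<in> S - {i}. v k = l}" for l
      using x unfolding split by auto
    moreover have "x k = v k" if "k \<notin> S - {i}" for k
      using that x assms(3) by (cases "k = i") (auto simp: rearrangements_def)
    ultimately show "x \<in> rearrangements (S - {i}) v"
      by (simp add: rearrangements_def)
  next
    fix x assume x: "x \<in> rearrangements (S - {i}) v"
    have xi: "x i = v i" using rearrangements_outside[OF x, of i] by simp
    have "card {k \<in> S. x k = l} = card {k \<in> S. u k = l}" for l
      unfolding u split using xi rearrangements_card[OF x] by simp
    moreover have "x k = u k" if "k \<notin> S" for k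
      using that rearrangements_outside[OF x, of k] rearrangements_outside[OF assms(3), of k]
      by simp
    ultimately show "x \<in> {x \<in> rearrangements S u. x i = v i}"
      using xi by (simp add: rearrangements_def)
  qed
qed

section \<open>One-coordinate marginals\<close>

lemma real_card_filter:
  "finite A \<Longrightarrow> real (card {x \<in> A. P x}) = (\<Sum>x\<in>A. of_bool (P x))"
  by (simp add: sum.If_cases of_bool_def Int_def)

text \<open>Double counting of the pairs \<open>(x, i)\<close> with \<open>x i = l\<close>: every
  \<open>x\<close> has the same number of coordinates of colour \<open>l\<close>. After
  normalisation, the marginals of \<open>A\<close> average to the colour frequency.\<close>

lemma sum_card_coordinate:
  assumes "finite S" "A \<subseteq> rearrangements S u"
  shows "(\<Sum>i\<in>S. real (card {x \<in> A. x i = l})) = real (card {k \<in> S. u k = l}) * real (card A)"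
proof -
  have fA: "finite A" using assms finite_rearrangements finite_subset by blast
  have "(\<Sum>i\<in>S. real (card {x \<in> A. x i = l})) = (\<Sum>x\<in>A. \<Sum>i\<in>S. of_bool (x i = l))"
    by (subst sum.swap) (simp only: real_card_filter[OF fA])
  also have "\<dots> = (\<Sum>x\<in>A. real (card {k \<in> S. u k = l}))"
  proof (rule sum.cong[OF refl])
    fix x assume "x \<in> A"
    then have "card {i \<in> S. x i = l} = card {k \<in> S. u k = l}"
      using assms(2) by (intro rearrangements_card) auto
    then show "(\<Sum>i\<in>S. of_bool (x i = l)) = real (card {k \<in> S. u k = l})"
      using real_card_filter[OF assms(1), of "\<lambda>i. x i = l"] by simp
  qed
  finally show ?thesis by simp
qed

text \<open>On the full set the transpositions act as bijections that permute the coordinates, so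
  all marginals coincide and each equals the average from
  \<open>sum_card_coordinate\<close>.\<close>

lemma card_coordinate:
  assumes "finite S" "i \<in> S"
  shows "real (card S) * real (card {x \<in> rearrangements S u. x i = l})
    = real (card {k \<in> S. u k = l}) * real (card (rearrangements S u))"
proof -
  have "card {x \<in> rearrangements S u. x j = l} = card {x \<in> rearrangements S u. x i = l}"
    if "j \<in> S" for j
    by (rule bij_betw_same_card[where f = "\<lambda>x. x \<circ> transpose i j"],
        rule bij_betw_byWitness[where f' = "\<lambda>x. x \<circ> transpose i j"])
       (use that assms comp_transpose_in_rearrangements in auto)
  then have "(\<Sum>j\<in>S. real (card {x \<in> rearrangements S u. x j = l}))
      = (\<Sum>j\<in>S. real (card {x \<in> rearrangements S u. x i = l}))"
    by (intro sum.cong) auto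
  then show ?thesis
    using sum_card_coordinate[OF assms(1) order_refl, of u l] by simp
qed

section \<open>Two estimates for the induction: marginal entropies and swap weights\<close>

text \<open>For \<open>r > 1\<close>, write \<open>r * ln r = (r - 1) * ln r + ln r\<close> and
  bound \<open>ln r\<close> by \<open>ln R\<close> in the first term and by \<open>r - 1\<close> in
  the second. For \<open>r \<le> 1\<close> the left side is nonpositive. The factor
  \<open>1 + ln R\<close> is the origin of the weight \<open>1 + ln (n / c)\<close>.\<close>

lemma mult_ln_le:
  fixes r R :: real
  assumes "0 < r" "r \<le> R" "1 \<le> R"
  shows "r * ln r \<le> (1 + ln R) * max 0 (r - 1)"
proof (cases "r \<le> 1")
  case True
  then show ?thesis using assms by (simp add: mult_nonneg_nonpos)
next
  case False
  have "r * ln r = (r - 1) * ln r + ln r" by (simp add: algebra_simps)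
  also have "\<dots> \<le> (r - 1) * ln R + (r - 1)"
    using False assms by (intro add_mono mult_left_mono ln_le_minus_one) auto
  also have "\<dots> = (1 + ln R) * max 0 (r - 1)" using False by (simp add: algebra_simps)
  finally show ?thesis .
qed

text \<open>Removing a coordinate \<open>i\<close> other than \<open>j, k\<close> and averaging over \<open>i\<close> increases the total
  weight by at most \<open>1 / n\<close>: the gain where \<open>x i = x j\<close> and the loss elsewhere nearly cancel.\<close>

lemma weight_step:
  fixes x :: "'a \<Rightarrow> 'b"
  assumes "finite S" "j \<in> S" "k \<in> S" "x j \<noteq> x k"
  defines "n \<equiv> real (card S)" and "c \<equiv> real (card {i \<in> S. x i = x j})"
  shows "(\<Sum>i\<in>S - {j, k}. 1 + ln ((n - 1) / real (card {m \<in> S - {i}. x m = x j})))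
    \<le> (n - 2) * (1 + ln (n / c)) + 1 / n"
proof -
  \<comment> \<open>Deleting a coordinate in \<open>E\<close> lowers the multiplicity of the colour
    \<open>x j\<close> from \<open>c\<close> to \<open>c - 1\<close>; deleting one in
    \<open>F\<close> leaves it at \<open>c\<close>.\<close>
  define E where "E = {i \<in> S - {j}. x i = x j}"
  define F where "F = {i \<in> S - {k}. x i \<noteq> x j}"
  define T where "T = {i \<in> S. x i = x j}"
  have fin: "finite E" "finite F" "finite T" using assms(1) by (auto simp: E_def F_def T_def)
  have EF: "S - {j, k} = E \<union> F" "E \<inter> F = {}" using assms(4) by (auto simp: E_def F_def)
  have ET: "E = T - {j}" and jT: "j \<in> T" using assms(2) by (auto simp: E_def T_def)
  have cT: "c = real (card T)" by (simp add: c_def T_def)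
  have c1: "c \<ge> 1" using jT fin unfolding cT by (metis Suc_leI card_gt_0_iff empty_iff of_nat_1 of_nat_mono One_nat_def)
  have cE: "real (card E) = c - 1"
    using jT fin c1 unfolding ET cT by (simp add: card_Diff_singleton of_nat_diff)
  have FT: "F = (S - T) - {k}" and kST: "k \<in> S - T" using assms(3,4) by (auto simp: F_def T_def)
  have TS: "T \<subseteq> S" by (auto simp: T_def)
  have cST: "real (card (S - T)) = n - c"
    using card_Diff_subset[OF fin(3) TS] card_mono[OF assms(1) TS] by (simp add: n_def cT of_nat_diff)
  have "card (S - T) > 0" using kST assms(1) by (auto simp: card_gt_0_iff)
  then have cF: "real (card F) = n - c - 1" and cn: "c \<le> n - 1"
    using kST cST assms(1) unfolding FT by (auto simp: card_Diff_singleton of_nat_diff)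
  have n2: "n \<ge> 2" using c1 cn by simp
  let ?h = "\<lambda>i. 1 + ln ((n - 1) / real (card {m \<in> S - {i}. x m = x j}))"
  let ?G = "1 + ln (n / c)"
  have "sum ?h E \<le> (c - 1) * ?G + (n - c) / n"
  \<comment> \<open>For \<open>c = 1\<close> the set \<open>E\<close> is empty, and the estimate per
    coordinate would divide by \<open>c - 1\<close>.\<close>
  proof (cases "c = 1")
    case True
    then have "E = {}" using cE fin by simp
    then show ?thesis using True n2 by simp
  next
    case False
    have "card T > 1" using False c1 cT by linarith
    then have c2: "c \<ge> 2" using cT by simp
    have "?h i \<le> ?G + (n - c) / (n * (c - 1))" if "i \<in> E" for i
    proof -
      have "{m \<in> S - {i}. x m = x j} = T - {i}" by (auto simp: T_def)
      moreover have "i \<in> T" using that by (simp add: ET)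
      ultimately have card: "real (card {m \<in> S - {i}. x m = x j}) = c - 1"
        using fin c1 unfolding cT by (simp add: card_Diff_singleton of_nat_diff)
      \<comment> \<open>The second factor exceeds 1 by \<open>(n - c) / (n * (c - 1))\<close>; over
        the \<open>c - 1\<close> coordinates of \<open>E\<close> this totals
        \<open>(n - c) / n\<close>.\<close>
      have "(n - 1) / (c - 1) = n / c * (((n - 1) * c) / (n * (c - 1)))"
        using c2 n2 by (simp add: field_simps)
      then have "ln ((n - 1) / (c - 1)) = ln (n / c * (((n - 1) * c) / (n * (c - 1))))"
        by (rule arg_cong)
      also have "\<dots> = ln (n / c) + ln (((n - 1) * c) / (n * (c - 1)))"
        using c2 n2 by (intro ln_mult_pos) auto
      also have "\<dots> \<le> ln (n / c) + (((n - 1) * c) / (n * (c - 1)) - 1)"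
        using c2 n2 by (intro add_left_mono ln_le_minus_one) simp
      also have "\<dots> = ln (n / c) + (n - c) / (n * (c - 1))"
        using c2 n2 by (simp add: field_simps)
      finally show ?thesis unfolding card by simp
    qed
    then have "sum ?h E \<le> (\<Sum>i\<in>E. ?G + (n - c) / (n * (c - 1)))" by (rule sum_mono)
    also have "\<dots> = (c - 1) * ?G + (n - c) / n"
      using c2 n2 by (simp add: cE field_simps)
    finally show ?thesis .
  qed
  moreover have "sum ?h F \<le> (n - c - 1) * (?G - 1 / n)"
  proof -
    have "?h i \<le> ?G - 1 / n" if "i \<in> F" for i
    proof -
      have "{m \<in> S - {i}. x m = x j} = T" using that by (auto simp: T_def F_def)
      then have card: "real (card {m \<in> S - {i}. x m = x j}) = c" by (simp add: cT)
      have "(n - 1) / c = n / c * ((n - 1) / n)" using n2 by simp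
      then have "ln ((n - 1) / c) = ln (n / c * ((n - 1) / n))"
        by (rule arg_cong)
      also have "\<dots> = ln (n / c) + ln ((n - 1) / n)"
        using c1 n2 by (intro ln_mult_pos) auto
      also have "\<dots> \<le> ln (n / c) + ((n - 1) / n - 1)"
        using n2 by (intro add_left_mono ln_le_minus_one) simp
      also have "\<dots> = ln (n / c) - 1 / n" using n2 by (simp add: field_simps)
      finally show ?thesis unfolding card by simp
    qed
    then have "sum ?h F \<le> (\<Sum>i\<in>F. ?G - 1 / n)" by (rule sum_mono)
    then show ?thesis by (simp add: cF)
  qed
  moreover have "sum ?h (S - {j, k}) = sum ?h E + sum ?h F"
    unfolding EF(1) using fin EF(2) by (intro sum.union_disjoint)
  \<comment> \<open>The gain \<open>(n - c) / n\<close> on \<open>E\<close> against the loss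
    \<open>(n - c - 1) / n\<close> on \<open>F\<close> leaves \<open>1 / n\<close>.\<close>
  moreover have "(c - 1) * ?G + (n - c) / n + (n - c - 1) * (?G - 1 / n)
      = (n - 2) * ?G + 1 / n"
    using n2 by (simp add: field_simps)
  ultimately show ?thesis by linarith
qed

text \<open>The mean of \<open>p\<close> over \<open>S\<close> is \<open>q = a * c / n\<close>, and
  \<open>p i \<le> a\<close> gives \<open>p i / q \<le> n / c\<close>, so \<open>mult_ln_le\<close>
  applies with \<open>R = n / c\<close>. The positive part of \<open>p i - q\<close> is then
  controlled by averaging \<open>p i - p j\<close> over \<open>j\<close>: the points with value
  \<open>l\<close> at \<open>i\<close> that stay in \<open>A\<close> under the swap inject into
  those with value \<open>l\<close> at \<open>j\<close>.\<close>

lemma sum_coordinate_divergence_le: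
  fixes u :: "'a \<Rightarrow> 'b"
  assumes "finite S" "A \<subseteq> rearrangements S u" "A \<noteq> {}" "l \<in> u ` S"
  defines "n \<equiv> real (card S)" and "c \<equiv> real (card {k \<in> S. u k = l})"
    and "p \<equiv> \<lambda>i. real (card {x \<in> A. x i = l})"
  shows "(\<Sum>i\<in>S. p i * ln (p i * n / (real (card A) * c)))
    \<le> (1 + ln (n / c)) / n
        * (\<Sum>i\<in>S. \<Sum>j\<in>S. real (card {x \<in> A. x i = l \<and> x \<circ> transpose i j \<notin> A}))"
proof -
  define a where "a = real (card A)"
  define q where "q = a * c / n"
  let ?s = "\<lambda>i j. real (card {x \<in> A. x i = l \<and> x \<circ> transpose i j \<notin> A})"
  have fA: "finite A" using assms finite_rearrangements finite_subset by blast
  have apos: "a > 0" using fA assms(3) by (simp add: a_def card_gt_0_iff)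
  have npos: "n > 0" using assms(1,4) by (auto simp: n_def card_gt_0_iff)
  have cpos: "c > 0" using assms(1,4) by (auto simp: c_def card_gt_0_iff)
  have cn: "c \<le> n" unfolding c_def n_def using assms(1) by (simp add: card_mono)
  have qpos: "q > 0" using apos npos cpos by (simp add: q_def)
  have sump: "sum p S = n * q"
    using sum_card_coordinate[OF assms(1,2), of l] npos by (simp add: p_def c_def a_def q_def)
  have diff: "p i - p j \<le> ?s i j" for i j
  proof -
    let ?B = "{x \<in> A. x i = l \<and> x \<circ> transpose i j \<in> A}"
    have "card {x \<in> A. x i = l} = card ?B + card {x \<in> A. x i = l \<and> x \<circ> transpose i j \<notin> A}"
      using fA by (subst card_Un_disjoint[symmetric]) (auto intro!: arg_cong[where f = card])
    moreover have "card ?B \<le> card {x \<in> A. x j = l}"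
    proof (rule card_inj_on_le[where f = "\<lambda>x. x \<circ> transpose i j"])
      show "inj_on (\<lambda>x. x \<circ> transpose i j) ?B"
        by (rule inj_on_inverseI[where g = "\<lambda>x. x \<circ> transpose i j"]) simp
    qed (use fA in auto)
    ultimately show ?thesis unfolding p_def by linarith
  qed
  have G: "1 + ln (n / c) \<ge> 0" using cpos cn by simp
  have "p i * ln (p i * n / (a * c)) \<le> (1 + ln (n / c)) * max 0 (p i - q)" for i
  proof (cases "p i = 0")
    case True
    then show ?thesis using G by simp
  next
    case False
    have pos: "p i > 0" using False by (simp add: p_def)
    have pa: "p i \<le> a" unfolding p_def a_def using fA by (simp add: card_mono)
    let ?r = "p i / q"
    have r: "p i * n / (a * c) = ?r" by (simp add: q_def)
    have "?r * ln ?r \<le> (1 + ln (n / c)) * max 0 (?r - 1)"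
    proof (rule mult_ln_le)
      show "?r \<le> n / c"
        using pa apos npos cpos by (simp add: q_def field_simps)
    qed (use pos qpos cpos cn in auto)
    then have "q * (?r * ln ?r) \<le> q * ((1 + ln (n / c)) * max 0 (?r - 1))"
      using qpos by (intro mult_left_mono) auto
    also have "\<dots> = (1 + ln (n / c)) * (q * max 0 (?r - 1))" by simp
    also have "q * max 0 (?r - 1) = max 0 (p i - q)"
      using qpos by (simp add: max_def field_simps)
    finally show ?thesis unfolding r using qpos by simp
  qed
  then have "(\<Sum>i\<in>S. p i * ln (p i * n / (a * c)))
      \<le> (\<Sum>i\<in>S. (1 + ln (n / c)) * max 0 (p i - q))"
    by (rule sum_mono)
  also have "\<dots> \<le> (\<Sum>i\<in>S. (1 + ln (n / c)) * ((\<Sum>j\<in>S. ?s i j) / n))"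
  proof (intro sum_mono mult_left_mono G)
    fix i
    have "n * (p i - q) = (\<Sum>j\<in>S. p i - p j)"
      by (simp add: sum_subtractf sump n_def algebra_simps)
    also have "\<dots> \<le> (\<Sum>j\<in>S. ?s i j)" by (intro sum_mono diff)
    finally have "p i - q \<le> (\<Sum>j\<in>S. ?s i j) / n"
      using npos by (simp add: field_simps)
    moreover have "0 \<le> (\<Sum>j\<in>S. ?s i j) / n"
      using npos by (intro divide_nonneg_pos sum_nonneg) auto
    ultimately show "max 0 (p i - q) \<le> (\<Sum>j\<in>S. ?s i j) / n" by simp
  qed
  also have "\<dots> = (1 + ln (n / c)) / n * (\<Sum>i\<in>S. \<Sum>j\<in>S. ?s i j)"
    unfolding sum_distrib_left times_divide_eq_right times_divide_eq_left sum_divide_distrib ..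
  finally show ?thesis by (simp add: a_def)
qed

section \<open>The entropy inequality, by induction on the number of coordinates\<close>

text \<open>Summing the chain rule over all coordinates turns the left side into
  \<open>?T1 + ?T2\<close>. The conditional part \<open>?T1\<close> is bounded by the induction
  hypothesis on the fibres together with \<open>weight_step\<close>, the marginal part
  \<open>?T2\<close> by \<open>?W / n\<close>, where \<open>?W\<close> is the right side. The
  \<open>1 / n\<close> lost to the marginals is exactly what the conditional part leaves
  free.\<close>

lemma log_isoperimetric_rearrangements:
  fixes u :: "'a \<Rightarrow> 'b"
  assumes "finite S" "A \<subseteq> rearrangements S u" "A \<noteq> {}"
  shows "real (card S) * (real (card A) * ln (real (card (rearrangements S u)) / real (card A)))
    \<le> (\<Sum>x\<in>A. \<Sum>i\<in>S. \<Sum>j\<in>S. of_bool (x \<circ> transpose i j \<notin> A)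
          * (1 + ln (real (card S) / real (card {k \<in> S. x k = x i}))))"
  using assms
proof (induction "card S" arbitrary: S u A rule: less_induct)
  case less
  note finS = less.prems(1) and AO = less.prems(2) and Ane = less.prems(3)
  define Om where "Om = rearrangements S u"
  define n where "n = real (card S)"
  define a where "a = real (card A)"
  define N where "N = real (card Om)"
  define c where "c l = real (card {k \<in> S. u k = l})" for l
  define G where "G l = 1 + ln (n / c l)" for l
  define e where "e x i j = (of_bool (x \<circ> transpose i j \<notin> A) :: real)" for x i j
  have finOm: "finite Om" unfolding Om_def by (rule finite_rearrangements[OF finS])
  have finA: "finite A" using finOm AO finite_subset unfolding Om_def by blast
  have apos: "a > 0" using finA Ane by (simp add: a_def card_gt_0_iff)
  have Npos: "N > 0" using finOm rearrangements_refl[of u S]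
    by (auto simp: N_def Om_def card_gt_0_iff)
  have cx: "real (card {k \<in> S. x k = l}) = c l" if "x \<in> A" for x l
    using that AO rearrangements_card unfolding c_def by fastforce
  have cpos: "c l > 0" if "l \<in> u ` S" for l
    using that finS by (auto simp: c_def card_gt_0_iff)
  have cn: "c l \<le> n" for l unfolding c_def n_def using finS by (simp add: card_mono)
  have G1: "G l \<ge> 1" if "l \<in> u ` S" for l
    using cpos[OF that] cn[of l] by (simp add: G_def)
  have xS: "x i \<in> u ` S" if "x \<in> A" "i \<in> S" for x i
    using that AO rearrangements_image[OF finS] by blast
  have e0: "e x i j \<ge> 0" for x i j by (simp add: e_def)
  have "n * (a * ln (N / a)) \<le> (\<Sum>x\<in>A. \<Sum>i\<in>S. \<Sum>j\<in>S. e x i j * G (x i))"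
  proof (cases "card S \<le> 1")
    case True
    \<comment> \<open>With at most one coordinate there is a single rearrangement, so the logarithm
      is nonpositive. The general step divides by \<open>n - 1\<close>.\<close>
    have "Om \<subseteq> {u}"
    proof
      fix x assume x: "x \<in> Om"
      have "x i = u i" for i
      proof (cases "i \<in> S")
        case i: True
        then have "S = {i}" using True card_le_Suc0_iff_eq[OF finS] by auto
        moreover have "x i \<in> u ` S"
          using rearrangements_image[OF finS _ i] x by (simp add: Om_def)
        ultimately show ?thesis by simp
      qed (use x rearrangements_outside Om_def in fast)
      then show "x \<in> {u}" by auto
    qed
    then have "N \<le> 1" unfolding N_def using card_mono[of "{u}" Om] by simp
    moreover have "a \<ge> 1" using apos by (simp add: a_def)
    ultimately have "N / a \<le> 1" "N / a > 0" using Npos by (simp_all add: field_simps)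
    then have "ln (N / a) \<le> 0" by simp
    then have "n * (a * ln (N / a)) \<le> 0"
      using apos by (simp add: n_def mult_nonneg_nonpos)
    also have "0 \<le> (\<Sum>x\<in>A. \<Sum>i\<in>S. \<Sum>j\<in>S. e x i j * G (x i))"
      using e0 G1[OF xS] by (intro sum_nonneg mult_nonneg_nonneg) (auto intro: order_trans[of 0 1])
    finally show ?thesis .
  next
    case False
    then have n2: "n \<ge> 2" by (simp add: n_def)
    define p where "p i l = real (card {x \<in> A. x i = l})" for i l
    define V where "V = u ` S"
    have finV: "finite V" using finS by (simp add: V_def)
    have part: "(\<Sum>l\<in>V. \<Sum>x\<in>{x \<in> A. x i = l}. f x) = sum f A" if "i \<in> S" for i and f :: "_ \<Rightarrow> real"
      using xS[OF _ that] by (intro sum.group finA finV) (auto simp: V_def)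
    have sump: "(\<Sum>l\<in>V. p i l) = a" if "i \<in> S" for i
      using part[OF that, of "\<lambda>_. 1"] by (simp add: p_def a_def)
    \<comment> \<open>Chain rule at coordinate \<open>i\<close>, without normalisation: the fibre of
      \<open>A\<close> over \<open>l\<close> has \<open>p i l\<close> points, that of
      \<open>Om\<close> has \<open>c l * N / n\<close>. Empty fibres contribute zero through the
      factor \<open>p i l\<close>.\<close>
    have chain: "a * ln (N / a) = (\<Sum>l\<in>V. p i l * ln (c l * N / n / p i l))
        + (\<Sum>l\<in>V. p i l * ln (p i l * n / (a * c l)))" if "i \<in> S" for i
    proof -
      have "p i l * ln (N / a) = p i l * ln (c l * N / n / p i l) + p i l * ln (p i l * n / (a * c l))"
        if "l \<in> V" for l
      proof (cases "p i l = 0")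
        case False
        then have pp: "p i l > 0" by (simp add: p_def)
        have cc: "c l > 0" using cpos that by (simp add: V_def)
        have "N / a = (c l * N / n / p i l) * (p i l * n / (a * c l))"
          using pp cc n2 by simp
        then have "ln (N / a) = ln ((c l * N / n / p i l) * (p i l * n / (a * c l)))"
          by (rule arg_cong)
        also have "\<dots> = ln (c l * N / n / p i l) + ln (p i l * n / (a * c l))"
          using pp cc n2 Npos apos by (intro ln_mult_pos) auto
        finally show ?thesis by (simp only: distrib_left)
      qed simp
      then have "(\<Sum>l\<in>V. p i l * ln (N / a)) = (\<Sum>l\<in>V. p i l * ln (c l * N / n / p i l))
        + (\<Sum>l\<in>V. p i l * ln (p i l * n / (a * c l)))"
        by (simp only: sum.distrib[symmetric] cong: sum.cong)
      then show ?thesis by (simp only: sum_distrib_right[symmetric] sump[OF that])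
    qed
    let ?g = "\<lambda>i x j. 1 + ln ((n - 1) / real (card {m \<in> S - {i}. x m = x j}))"
    have IH: "(n - 1) * (\<Sum>l\<in>V. p i l * ln (c l * N / n / p i l))
        \<le> (\<Sum>x\<in>A. \<Sum>j\<in>S - {i}. \<Sum>k\<in>S - {i}. e x j k * ?g i x j)" if i: "i \<in> S" for i
    proof -
      have "(n - 1) * (p i l * ln (c l * N / n / p i l))
        \<le> (\<Sum>x\<in>{x \<in> A. x i = l}. \<Sum>j\<in>S - {i}. \<Sum>k\<in>S - {i}. e x j k * ?g i x j)"
        if "l \<in> V" for l
      proof (cases "p i l = 0")
        case True
        then have "{x \<in> A. x i = l} = {}" using finA by (simp add: p_def)
        then show ?thesis unfolding True by (simp only: sum.empty mult_zero_left mult_zero_right)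
      next
        case False
        let ?B = "{x \<in> A. x i = l}"
        \<comment> \<open>Any point of the nonempty fibre serves as the base point for the induction
          hypothesis.\<close>
        obtain v where v: "v \<in> A" "v i = l" using False by (auto simp: p_def card_eq_0_iff)
        have "v \<in> rearrangements S u" using v AO by blast
        from rearrangements_fix_coordinate[OF finS i this]
        have R: "rearrangements (S - {i}) v = {x \<in> Om. x i = l}" by (simp add: v Om_def)
        have cR: "real (card (rearrangements (S - {i}) v)) = c l * N / n"
          using card_coordinate[OF finS i, of u l] n2
          unfolding R Om_def[symmetric] N_def[symmetric] n_def[symmetric] c_def[symmetric]
          by (simp add: field_simps)
        have cS: "real (card (S - {i})) = n - 1"
          using i n2 by (simp add: card_Diff_singleton n_def of_nat_diff)
        have "real (card (S - {i})) * (real (card ?B)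
             * ln (real (card (rearrangements (S - {i}) v)) / real (card ?B)))
          \<le> (\<Sum>x\<in>?B. \<Sum>j\<in>S - {i}. \<Sum>k\<in>S - {i}. of_bool (x \<circ> transpose j k \<notin> ?B)
          * (1 + ln (real (card (S - {i})) / real (card {m \<in> S - {i}. x m = x j}))))"
        proof (rule less.hyps)
          show "card (S - {i}) < card S" using finS i by (rule card_Diff1_less)
          show "?B \<subseteq> rearrangements (S - {i}) v" unfolding R Om_def using AO by blast
        qed (use finS v in auto)
        \<comment> \<open>A swap within \<open>S - {i}\<close> preserves the value at
          \<open>i\<close>, so it leaves the fibre exactly when it leaves \<open>A\<close>.\<close>
        also have "\<dots> = (\<Sum>x\<in>?B. \<Sum>j\<in>S - {i}. \<Sum>k\<in>S - {i}. e x j k * ?g i x j)"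
          unfolding cS e_def by (intro sum.cong refl) (auto simp: transpose_def)
        finally show ?thesis unfolding cS cR p_def .
      qed
      then have "(\<Sum>l\<in>V. (n - 1) * (p i l * ln (c l * N / n / p i l)))
        \<le> (\<Sum>l\<in>V. \<Sum>x\<in>{x \<in> A. x i = l}. \<Sum>j\<in>S - {i}. \<Sum>k\<in>S - {i}. e x j k * ?g i x j)"
        by (rule sum_mono)
      then show ?thesis unfolding part[OF i] by (simp only: sum_distrib_left)
    qed
    let ?T1 = "\<Sum>i\<in>S. \<Sum>l\<in>V. p i l * ln (c l * N / n / p i l)"
    let ?T2 = "\<Sum>i\<in>S. \<Sum>l\<in>V. p i l * ln (p i l * n / (a * c l))"
    let ?W = "\<Sum>x\<in>A. \<Sum>i\<in>S. \<Sum>j\<in>S. e x i j * G (x i)"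
    let ?E = "\<Sum>x\<in>A. \<Sum>i\<in>S. \<Sum>j\<in>S. e x i j"
    have T1: "(n - 1) * ?T1 \<le> (n - 2) * ?W + ?E / n"
    proof -
      have "(n - 1) * ?T1 \<le> (\<Sum>i\<in>S. \<Sum>x\<in>A. \<Sum>j\<in>S - {i}. \<Sum>k\<in>S - {i}. e x j k * ?g i x j)"
        unfolding sum_distrib_left[of "n - 1" _ S] by (intro sum_mono IH)
      \<comment> \<open>The indicator makes all ranges equal to \<open>S\<close>, so that the sum
        over the deleted coordinate \<open>i\<close> can be moved innermost and bounded by
        \<open>weight_step\<close>.\<close>
      also have "\<dots> = (\<Sum>i\<in>S. \<Sum>x\<in>A. \<Sum>j\<in>S. \<Sum>k\<in>S. of_bool (i \<notin> {j, k}) * (e x j k * ?g i x j))"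
        using finS by (intro sum.cong refl sum.mono_neutral_cong_left)
          (auto intro!: sum.neutral sum.mono_neutral_cong_left)
      also have "\<dots> = (\<Sum>x\<in>A. \<Sum>j\<in>S. \<Sum>k\<in>S. \<Sum>i\<in>S. of_bool (i \<notin> {j, k}) * (e x j k * ?g i x j))"
        by (subst sum.swap, rule sum.cong[OF refl], subst sum.swap, rule sum.cong[OF refl],
            rule sum.swap)
      also have "\<dots> = (\<Sum>x\<in>A. \<Sum>j\<in>S. \<Sum>k\<in>S. e x j k * (\<Sum>i\<in>S - {j, k}. ?g i x j))"
        unfolding sum_distrib_left
        using finS by (intro sum.cong refl sum.mono_neutral_cong_right) auto
      also have "\<dots> \<le> (\<Sum>x\<in>A. \<Sum>j\<in>S. \<Sum>k\<in>S. e x j k * ((n - 2) * G (x j) + 1 / n))"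
      proof (intro sum_mono)
        fix x j k assume x: "x \<in> A" and j: "j \<in> S" and k: "k \<in> S"
        show "e x j k * (\<Sum>i\<in>S - {j, k}. ?g i x j) \<le> e x j k * ((n - 2) * G (x j) + 1 / n)"
        proof (cases "x j = x k")
          \<comment> \<open>Swapping equal values fixes \<open>x\<close>, which lies in
            \<open>A\<close>, so the indicator \<open>e x j k\<close> vanishes;
            \<open>weight_step\<close> covers only distinct values.\<close>
          case True
          then have "x \<circ> transpose j k = x" by (auto simp: transpose_def)
          then show ?thesis using x by (simp add: e_def)
        next
          case False
          from weight_step[where x = x, OF finS j k False]
          show ?thesis unfolding G_def cx[OF x] n_def[symmetric] by (intro mult_left_mono e0)
        qed
      qed
      also have "\<dots> = (n - 2) * ?W + ?E / n"
        by (simp only: distrib_left sum.distrib sum_distrib_left sum_divide_distrib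
            times_divide_eq_right times_divide_eq_left mult_1_right mult_1_left mult_ac)
      finally show ?thesis .
    qed
    have T2: "?T2 \<le> ?W / n"
    proof -
      have "?T2 = (\<Sum>l\<in>V. \<Sum>i\<in>S. p i l * ln (p i l * n / (a * c l)))" by (rule sum.swap)
      also have "\<dots> \<le> (\<Sum>l\<in>V. G l / n
          * (\<Sum>i\<in>S. \<Sum>j\<in>S. real (card {x \<in> A. x i = l \<and> x \<circ> transpose i j \<notin> A})))"
      proof (rule sum_mono)
        fix l assume "l \<in> V"
        then have "l \<in> u ` S" by (simp add: V_def)
        from sum_coordinate_divergence_le[OF finS AO Ane this]
        show "(\<Sum>i\<in>S. p i l * ln (p i l * n / (a * c l))) \<le> G l / n
          * (\<Sum>i\<in>S. \<Sum>j\<in>S. real (card {x \<in> A. x i = l \<and> x \<circ> transpose i j \<notin> A}))"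
          by (simp only: p_def n_def a_def c_def G_def)
      qed
      also have "\<dots> = (\<Sum>l\<in>V. \<Sum>i\<in>S. \<Sum>j\<in>S. \<Sum>x\<in>{x \<in> A. x i = l}. e x i j * G (x i) / n)"
        unfolding sum_distrib_left
      proof (intro sum.cong refl)
        fix l i j
        have "{x \<in> A. x i = l \<and> x \<circ> transpose i j \<notin> A}
            = {x \<in> {x \<in> A. x i = l}. x \<circ> transpose i j \<notin> A}" by auto
        then have card: "real (card {x \<in> A. x i = l \<and> x \<circ> transpose i j \<notin> A})
            = (\<Sum>x\<in>{x \<in> A. x i = l}. e x i j)"
          unfolding e_def using finA by (simp only: real_card_filter[OF finite_subset[OF Collect_restrict finA]])
        have "(\<Sum>x\<in>{x \<in> A. x i = l}. e x i j * G (x i) / n)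
            = (\<Sum>x\<in>{x \<in> A. x i = l}. e x i j * (G l / n))"
          by (rule sum.cong) simp_all
        also have "\<dots> = (\<Sum>x\<in>{x \<in> A. x i = l}. e x i j) * (G l / n)"
          by (rule sum_distrib_right[symmetric])
        finally have weight: "(\<Sum>x\<in>{x \<in> A. x i = l}. e x i j * G (x i) / n)
            = (\<Sum>x\<in>{x \<in> A. x i = l}. e x i j) * (G l / n)" .
        show "G l / n * real (card {x \<in> A. x i = l \<and> x \<circ> transpose i j \<notin> A})
            = (\<Sum>x\<in>{x \<in> A. x i = l}. e x i j * G (x i) / n)"
          unfolding card weight by (rule mult.commute)
      qed
      also have "\<dots> = (\<Sum>i\<in>S. \<Sum>j\<in>S. \<Sum>l\<in>V. \<Sum>x\<in>{x \<in> A. x i = l}. e x i j * G (x i) / n)"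
        by (subst sum.swap, rule sum.cong[OF refl], rule sum.swap)
      also have "\<dots> = (\<Sum>i\<in>S. \<Sum>j\<in>S. \<Sum>x\<in>A. e x i j * G (x i) / n)"
        by (rule sum.cong[OF refl], rule sum.cong[OF refl], rule part)
      also have "\<dots> = (\<Sum>x\<in>A. \<Sum>i\<in>S. \<Sum>j\<in>S. e x i j * G (x i) / n)"
        by (subst sum.swap[of _ S A], rule sum.cong[OF refl], rule sum.swap)
      also have "\<dots> = ?W / n" by (simp only: sum_divide_distrib)
      finally show ?thesis .
    qed
    \<comment> \<open>All weights are at least 1, so the surplus \<open>?E / n\<close> left by
      \<open>weight_step\<close> can itself be charged to \<open>?W\<close>.\<close>
    have EW: "?E \<le> ?W"
    proof (intro sum_mono)
      fix x i j assume "x \<in> A" "i \<in> S"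
      then have "1 \<le> G (x i)" by (intro G1 xS)
      then show "e x i j \<le> e x i j * G (x i)" by (simp add: e_def)
    qed
    have "n * (a * ln (N / a)) = (\<Sum>i\<in>S. a * ln (N / a))" by (simp add: n_def)
    also have "\<dots> = (\<Sum>i\<in>S. (\<Sum>l\<in>V. p i l * ln (c l * N / n / p i l))
        + (\<Sum>l\<in>V. p i l * ln (p i l * n / (a * c l))))"
      by (rule sum.cong[OF refl], rule chain)
    also have "\<dots> = ?T1 + ?T2" by (rule sum.distrib)
    finally have eq: "n * (a * ln (N / a)) = ?T1 + ?T2" .
    \<comment> \<open>since \<open>(n - 2) / (n - 1) + 1 / (n (n - 1)) = 1 - 1 / n\<close>\<close>
    have absorb: "t \<le> w - w / n" if "(n - 1) * t \<le> (n - 2) * w + v / n" "v \<le> w" for t v w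
    proof -
      have "v / n \<le> w / n" using that(2) n2 by (intro divide_right_mono) auto
      then have "(n - 1) * t \<le> (n - 2) * w + w / n" using that(1) by linarith
      also have "\<dots> = (n - 1) * (w - w / n)" using n2 by (simp add: field_simps)
      finally show ?thesis using n2 by simp
    qed
    show ?thesis using eq T2 absorb[OF T1 EW] by linarith
  qed
  also have "\<dots> = (\<Sum>x\<in>A. \<Sum>i\<in>S. \<Sum>j\<in>S. of_bool (x \<circ> transpose i j \<notin> A)
          * (1 + ln (real (card S) / real (card {k \<in> S. x k = x i}))))"
    by (intro sum.cong refl) (simp only: e_def G_def cx n_def)
  finally show ?case unfolding n_def a_def N_def Om_def .
qed

section \<open>The multislice and its edges in terms of swaps\<close>

text \<open>Multiplicities agree, and \<open>y\<close> loses the value \<open>x i\<close> at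
  coordinate \<open>i\<close>. The only other place of change is \<open>j\<close>, so
  \<open>y\<close> must regain the value there; exchanging the roles gives
  \<open>x j = y i\<close>.\<close>

lemma eq_comp_transpose:
  assumes "finite S" "x \<in> rearrangements S u" "y \<in> rearrangements S u"
    and "{k \<in> S. x k \<noteq> y k} = {i, j}" "i \<noteq> j"
  shows "y = x \<circ> transpose i j"
proof -
  have crossed: "y j = x i"
    if "x \<in> rearrangements S u" "y \<in> rearrangements S u" "{k \<in> S. x k \<noteq> y k} = {i, j}" "i \<noteq> j"
    for i j and x y :: "'a \<Rightarrow> 'b"
  proof (rule ccontr)
    assume neq: "y j \<noteq> x i"
    have i: "i \<in> S" "x i \<noteq> y i" using that(3) by blast+
    have "{k \<in> S. y k = x i} \<subset> {k \<in> S. x k = x i}"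
    proof
      show "{k \<in> S. y k = x i} \<subseteq> {k \<in> S. x k = x i}"
      proof
        fix k assume k: "k \<in> {k \<in> S. y k = x i}"
        then have "k \<noteq> i" "k \<noteq> j" using i neq by auto
        then have "k \<notin> {k \<in> S. x k \<noteq> y k}" using that(3) by auto
        then show "k \<in> {k \<in> S. x k = x i}" using k by auto
      qed
      show "{k \<in> S. y k = x i} \<noteq> {k \<in> S. x k = x i}" using i by (metis (mono_tags, lifting) mem_Collect_eq)
    qed
    then have "card {k \<in> S. y k = x i} < card {k \<in> S. x k = x i}"
      using assms(1) by (intro psubset_card_mono) auto
    then show False
      using rearrangements_card[OF that(1), of "x i"] rearrangements_card[OF that(2), of "x i"]
      by simp
  qed
  have "{k \<in> S. y k \<noteq> x k} = {i, j}"
    unfolding assms(4)[symmetric] by (rule Collect_cong) (simp add: eq_commute)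
  then have ij: "y j = x i" "x j = y i"
    using crossed[OF assms(2-5)] crossed[OF assms(3,2) _ assms(5)] by blast+
  have "y k = x k" if "k \<noteq> i" "k \<noteq> j" for k
  proof (cases "k \<in> S")
    case True
    have "k \<notin> {k \<in> S. x k \<noteq> y k}" unfolding assms(4) using that by simp
    then show ?thesis using True by simp
  next
    case False
    then show ?thesis
      using rearrangements_outside[OF assms(2)] rearrangements_outside[OF assms(3)] by simp
  qed
  then show ?thesis using ij by (auto simp: transpose_def)
qed

text \<open>Induction on the colours: reserve \<open>\<kappa> l\<close> elements of \<open>S\<close>
  for \<open>l\<close> and colour the rest with the remaining colours. This yields a point of the
  multislice.\<close>

lemma ex_function_with_fibre_cards:
  fixes \<kappa> :: "'b \<Rightarrow> nat"
  assumes "finite C" "finite S" "card S = (\<Sum>l\<in>C. \<kappa> l)"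
  shows "\<exists>f. f ` S \<subseteq> C \<and> (\<forall>l\<in>C. card {i \<in> S. f i = l} = \<kappa> l)"
  using assms
proof (induction C arbitrary: S rule: finite_induct)
  case empty
  then show ?case by simp
next
  case (insert l C)
  then have "\<kappa> l \<le> card S" by simp
  then obtain T where T: "T \<subseteq> S" "card T = \<kappa> l"
    by (meson obtain_subset_with_card_n)
  have finT: "finite T" using T insert.prems finite_subset by blast
  have "card (S - T) = (\<Sum>l\<in>C. \<kappa> l)"
    using T insert.prems insert.hyps finT by (simp add: card_Diff_subset)
  then obtain f where f: "f ` (S - T) \<subseteq> C" "\<forall>l\<in>C. card {i \<in> S - T. f i = l} = \<kappa> l"
    using insert.IH[of "S - T"] insert.prems by auto
  let ?g = "\<lambda>i. if i \<in> T then l else f i"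
  have "{i \<in> S. ?g i = l} = T" using T f(1) insert.hyps by auto
  moreover have "{i \<in> S. ?g i = m} = {i \<in> S - T. f i = m}" if "m \<in> C" for m
    using that insert.hyps by auto
  ultimately have "\<forall>m\<in>insert l C. card {i \<in> S. ?g i = m} = \<kappa> m"
    using T f by auto
  moreover have "?g ` S \<subseteq> insert l C" using f(1) by auto
  ultimately show ?case by blast
qed

lemma multislice_nonempty: "multislice L \<kappa> \<noteq> {}"
proof -
  let ?S = "{1..(\<Sum>l=1..L. \<kappa> l)}"
  obtain f where f: "f ` ?S \<subseteq> {1..L}" "\<forall>l\<in>{1..L}. card {i \<in> ?S. f i = l} = \<kappa> l"
    using ex_function_with_fibre_cards[of "{1..L}" ?S \<kappa>] by auto
  have "{i \<in> ?S. restrict f ?S i = l} = {i \<in> ?S. f i = l}" for l by auto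
  then have "restrict f ?S \<in> multislice L \<kappa>"
    unfolding multislice_def using f by (auto simp: image_subset_iff)
  then show ?thesis by blast
qed

text \<open>Any point can be the base point: outside the coordinates all points are
  \<open>undefined\<close>, and values outside \<open>{1..L}\<close> have count zero on both
  sides.\<close>

lemma multislice_eq_rearrangements:
  assumes "u \<in> multislice L \<kappa>"
  shows "multislice L \<kappa> = rearrangements {1..(\<Sum>l=1..L. \<kappa> l)} u"
proof -
  define S where "S = {1..(\<Sum>l=1..L. \<kappa> l)}"
  have ms: "multislice L \<kappa> =
      {\<omega> \<in> S \<rightarrow>\<^sub>E {1..L}. \<forall>l\<in>{1..L}. card {i \<in> S. \<omega> i = l} = \<kappa> l}"
    by (simp add: multislice_def S_def)
  have u: "u \<in> S \<rightarrow>\<^sub>E {1..L}" "\<And>l. l \<in> {1..L} \<Longrightarrow> card {i \<in> S. u i = l} = \<kappa> l"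
    using assms by (auto simp: ms)
  have "multislice L \<kappa> = rearrangements S u"
  proof (intro equalityI subsetI)
    fix x assume "x \<in> multislice L \<kappa>"
    then have x: "x \<in> S \<rightarrow>\<^sub>E {1..L}" "\<And>l. l \<in> {1..L} \<Longrightarrow> card {i \<in> S. x i = l} = \<kappa> l"
      by (auto simp: ms)
    have "card {i \<in> S. x i = l} = card {i \<in> S. u i = l}" for l
    proof (cases "l \<in> {1..L}")
      case False
      then have "{i \<in> S. x i = l} = {}" "{i \<in> S. u i = l} = {}" using x(1) u(1) by auto
      then show ?thesis by (simp only:)
    qed (simp add: x(2) u(2))
    moreover have "x i = u i" if "i \<notin> S" for i
      using that x(1) u(1) by (metis PiE_arb)
    ultimately show "x \<in> rearrangements S u" by (simp add: rearrangements_def)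
  next
    fix x assume x: "x \<in> rearrangements S u"
    have "finite S" by (simp add: S_def)
    then have "x i \<in> {1..L}" if "i \<in> S" for i
      using rearrangements_image[OF _ x that] u(1) by auto
    moreover have "x i = undefined" if "i \<notin> S" for i
      using that rearrangements_outside[OF x] u(1) by auto
    ultimately show "x \<in> multislice L \<kappa>"
      unfolding ms using rearrangements_card[OF x] u(2) by (auto intro: PiE_I)
  qed
  then show ?thesis by (simp add: S_def)
qed

lemma finite_edge_boundary: "finite (edge_boundary (multislice_edges L \<kappa>) A)"
proof (rule finite_subset)
  show "edge_boundary (multislice_edges L \<kappa>) A \<subseteq> Pow (multislice L \<kappa>)"
    by (auto simp: edge_boundary_def multislice_edges_def)
qed (simp add: finite_multislice)

text \<open>A triple \<open>(x, i, j)\<close> with \<open>i < j\<close> whose swap leaves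
  \<open>A\<close> determines a boundary edge and is recovered from it: \<open>x\<close> is the
  endpoint in \<open>A\<close>, and \<open>i, j\<close> are the coordinates where the endpoints
  differ. The factor 2 accounts for ordered pairs.\<close>

lemma sum_swaps_le_edge_boundary:
  fixes L :: nat and \<kappa> :: "nat \<Rightarrow> nat"
  defines "S \<equiv> {1..(\<Sum>l=1..L. \<kappa> l)}"
  assumes A: "A \<subseteq> multislice L \<kappa>"
  shows "(\<Sum>x\<in>A. \<Sum>i\<in>S. \<Sum>j\<in>S. of_bool (x \<circ> transpose i j \<notin> A))
    \<le> 2 * real (card (edge_boundary (multislice_edges L \<kappa>) A))"
proof -
  define T where "T = {(x, i, j) \<in> A \<times> S \<times> S. i < j \<and> x \<circ> transpose i j \<notin> A}"
  have finS: "finite S" by (simp add: S_def)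
  have finA: "finite A" using A finite_multislice finite_subset by blast
  have diff: "{k \<in> S. x k \<noteq> (x \<circ> transpose i j) k} = {i, j}"
    if "(x, i, j) \<in> T" for x i j
  proof -
    have "x i \<noteq> x j"
    proof
      assume "x i = x j"
      then have "x \<circ> transpose i j = x" by (auto simp: transpose_def)
      then show False using that by (auto simp: T_def)
    qed
    then show ?thesis using that by (auto simp: T_def transpose_def)
  qed
  let ?f = "\<lambda>(x, i, j). {x, x \<circ> transpose i j}"
  have "inj_on ?f T"
  proof (rule inj_onI)
    fix s s' assume s: "s \<in> T" "s' \<in> T" "?f s = ?f s'"
    obtain x i j x' i' j' where ss: "s = (x, i, j)" "s' = (x', i', j')"
      by (metis prod_cases3)
    have t: "(x, i, j) \<in> T" and t': "(x', i', j') \<in> T"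
      and eq: "{x, x \<circ> transpose i j} = {x', x' \<circ> transpose i' j'}"
      using s unfolding ss by simp_all
    have "x \<in> A" "x' \<in> A" "x \<circ> transpose i j \<notin> A" "x' \<circ> transpose i' j' \<notin> A"
      using t t' by (auto simp: T_def)
    then have x: "x' = x" and y: "x' \<circ> transpose i' j' = x \<circ> transpose i j"
      using eq by (auto simp: doubleton_eq_iff)
    have "{i, j} = {i', j'}" using diff[OF t] diff[OF t'] unfolding y unfolding x by simp
    moreover have "i < j" "i' < j'" using t t' by (auto simp: T_def)
    ultimately show "s = s'" using x unfolding ss by (auto simp: doubleton_eq_iff)
  qed
  moreover have "?f ` T \<subseteq> edge_boundary (multislice_edges L \<kappa>) A"
  proof (rule image_subsetI)
    fix s assume s: "s \<in> T"
    obtain x i j where ss: "s = (x, i, j)" by (metis prod_cases3)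
    have t: "(x, i, j) \<in> T" using s unfolding ss .
    then have tt: "x \<in> A" "i \<in> S" "j \<in> S" "i < j" "x \<circ> transpose i j \<notin> A"
      by (auto simp: T_def)
    have x: "x \<in> multislice L \<kappa>" using tt A by blast
    have y: "x \<circ> transpose i j \<in> multislice L \<kappa>"
      using comp_transpose_in_rearrangements[OF rearrangements_refl tt(2,3)]
      unfolding multislice_eq_rearrangements[OF x] S_def .
    have "card {k \<in> S. x k \<noteq> (x \<circ> transpose i j) k} = 2"
      unfolding diff[OF t] using tt(4) by simp
    then have "{x, x \<circ> transpose i j} \<in> multislice_edges L \<kappa>"
      unfolding multislice_edges_def S_def using x y by blast
    then have "{x, x \<circ> transpose i j} \<in> edge_boundary (multislice_edges L \<kappa>) A"
      unfolding edge_boundary_def using tt by blast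
    then show "?f s \<in> edge_boundary (multislice_edges L \<kappa>) A" by (simp add: ss)
  qed
  ultimately have "card T \<le> card (edge_boundary (multislice_edges L \<kappa>) A)"
    by (intro card_inj_on_le finite_edge_boundary)
  moreover have "(\<Sum>x\<in>A. \<Sum>i\<in>S. \<Sum>j\<in>S. of_bool (x \<circ> transpose i j \<notin> A)) \<le> 2 * real (card T)"
  proof -
    let ?h = "\<lambda>x i j. of_bool (i < j \<and> x \<circ> transpose i j \<notin> A) :: real"
    have "(\<Sum>x\<in>A. \<Sum>i\<in>S. \<Sum>j\<in>S. of_bool (x \<circ> transpose i j \<notin> A))
        \<le> (\<Sum>x\<in>A. \<Sum>i\<in>S. \<Sum>j\<in>S. ?h x i j + ?h x j i)"
    proof (intro sum_mono)
      fix x and i j :: nat assume x: "x \<in> A"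
      \<comment> \<open>On the diagonal both sides vanish, since the transposition is the identity
        and \<open>x\<close> lies in \<open>A\<close>.\<close>
      consider "i < j" | "i = j" | "j < i" by linarith
      then show "of_bool (x \<circ> transpose i j \<notin> A) \<le> ?h x i j + ?h x j i"
        using x by cases (simp_all add: transpose_commute)
    qed
    also have "\<dots> = (\<Sum>x\<in>A. (\<Sum>i\<in>S. \<Sum>j\<in>S. ?h x i j) + (\<Sum>i\<in>S. \<Sum>j\<in>S. ?h x j i))"
      by (simp only: sum.distrib)
    also have "\<dots> = (\<Sum>x\<in>A. 2 * (\<Sum>i\<in>S. \<Sum>j\<in>S. ?h x i j))"
    proof (rule sum.cong[OF refl])
      fix x
      have "(\<Sum>i\<in>S. \<Sum>j\<in>S. ?h x j i) = (\<Sum>i\<in>S. \<Sum>j\<in>S. ?h x i j)" by (rule sum.swap)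
      then show "(\<Sum>i\<in>S. \<Sum>j\<in>S. ?h x i j) + (\<Sum>i\<in>S. \<Sum>j\<in>S. ?h x j i)
          = 2 * (\<Sum>i\<in>S. \<Sum>j\<in>S. ?h x i j)" by linarith
    qed
    also have "\<dots> = 2 * (\<Sum>(x, i, j)\<in>A \<times> S \<times> S. ?h x i j)"
      by (simp only: sum_distrib_left[symmetric] sum.cartesian_product)
    also have "(\<Sum>(x, i, j)\<in>A \<times> S \<times> S. ?h x i j)
        = (\<Sum>t\<in>A \<times> S \<times> S. of_bool (case t of (x, i, j) \<Rightarrow> i < j \<and> x \<circ> transpose i j \<notin> A))"
      by (rule sum.cong) auto
    also have "\<dots> = real (card {t \<in> A \<times> S \<times> S. case t of (x, i, j) \<Rightarrow> i < j \<and> x \<circ> transpose i j \<notin> A})"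
      using finA finS by (intro real_card_filter[symmetric]) auto
    also have "{t \<in> A \<times> S \<times> S. case t of (x, i, j) \<Rightarrow> i < j \<and> x \<circ> transpose i j \<notin> A} = T"
      unfolding T_def by auto
    finally show ?thesis .
  qed
  ultimately show ?thesis by linarith
qed

text \<open>Within the multislice, membership in \<open>A\<close> depends on coordinate
  \<open>i\<close> alone, so a boundary edge changes that coordinate. By
  \<open>eq_comp_transpose\<close> it swaps \<open>i\<close> with some \<open>j\<close>, which
  leaves at most \<open>n\<close> edges for each \<open>x\<close>.\<close>

lemma card_edge_boundary_coordinate_le:
  fixes L i l :: nat and \<kappa> :: "nat \<Rightarrow> nat"
  defines "n \<equiv> (\<Sum>l=1..L. \<kappa> l)"
  assumes i: "i \<in> {1..n}"
  defines "A \<equiv> {x \<in> multislice L \<kappa>. x i = l}"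
  shows "card (edge_boundary (multislice_edges L \<kappa>) A) \<le> card A * n"
proof -
  let ?f = "\<lambda>(x, j). {x, x \<circ> transpose i j}"
  have finA: "finite A" using finite_multislice by (simp add: A_def)
  have "edge_boundary (multislice_edges L \<kappa>) A \<subseteq> ?f ` (A \<times> {1..n})"
  proof
    fix e assume "e \<in> edge_boundary (multislice_edges L \<kappa>) A"
    then obtain x y v w where e: "e = {x, y}" "x \<in> A" "y \<notin> A" "e = {v, w}"
      and vw: "v \<in> multislice L \<kappa>" "w \<in> multislice L \<kappa>" "card {k \<in> {1..n}. v k \<noteq> w k} = 2"
      unfolding edge_boundary_def multislice_edges_def n_def by blast
    have "{k \<in> {1..n}. w k \<noteq> v k} = {k \<in> {1..n}. v k \<noteq> w k}" by auto
    moreover have "x = v \<and> y = w \<or> x = w \<and> y = v"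
      using e by (auto simp: doubleton_eq_iff)
    ultimately have y: "y \<in> multislice L \<kappa>" and two: "card {k \<in> {1..n}. x k \<noteq> y k} = 2"
      using vw by auto
    have x: "x \<in> multislice L \<kappa>" using e(2) by (simp add: A_def)
    have mem: "i \<in> {k \<in> {1..n}. x k \<noteq> y k}" using i e(2,3) y by (auto simp: A_def)
    obtain v w where vw: "{k \<in> {1..n}. x k \<noteq> y k} = {v, w}" "v \<noteq> w"
      using two unfolding card_2_iff by blast
    have "i = v \<or> i = w" using mem unfolding vw(1) by simp
    then obtain j where j: "{k \<in> {1..n}. x k \<noteq> y k} = {i, j}" "i \<noteq> j"
      using vw by (metis insert_commute)
    then have "j \<in> {1..n}" by blast
    then have "(x, j) \<in> A \<times> {1..n}" using e(2) by blast
    moreover have "y \<in> rearrangements {1..n} x"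
      using y unfolding multislice_eq_rearrangements[OF x] n_def .
    then have "y = x \<circ> transpose i j"
      by (intro eq_comp_transpose[OF _ rearrangements_refl _ j]) simp_all
    then have "e = ?f (x, j)" using e(1) by simp
    ultimately show "e \<in> ?f ` (A \<times> {1..n})" by (rule rev_image_eqI)
  qed
  then have "card (edge_boundary (multislice_edges L \<kappa>) A) \<le> card (A \<times> {1..n})"
    using finA by (intro surj_card_le) auto
  then show ?thesis by (simp add: card_cartesian_product)
qed

theorem corollary1:
  fixes L n \<kappa>_min :: nat and \<kappa> :: "nat \<Rightarrow> nat"
  assumes "L \<ge> 2"
    and "\<forall>l\<in>{1..L}. \<kappa> l > 0"
    and "n = (\<Sum>l=1..L. \<kappa> l)"
    and "\<kappa>_min = Min (\<kappa> ` {1..L})"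
  shows "(ln 2 / 4) * (real n / ln (real n / real \<kappa>_min)) \<le> iota L \<kappa> \<and>
         iota L \<kappa> \<le> real n / ln (real n / real \<kappa>_min)"
proof
  define Om where "Om = multislice L \<kappa>"
  define S where "S = {1..n}"
  define y where "y = real n / real \<kappa>_min"
  have finOm: "finite Om" by (simp add: Om_def finite_multislice)
  have finS: "finite S" and cardS: "card S = n" by (simp_all add: S_def)
  have "\<kappa>_min \<in> \<kappa> ` {1..L}" using assms(1) unfolding assms(4) by (intro Min_in) auto
  then obtain m where m: "m \<in> {1..L}" "\<kappa>_min = \<kappa> m" by auto
  have minpos: "\<kappa>_min > 0" using m assms(2) by simp
  have min_le: "\<kappa>_min \<le> \<kappa> l" if "l \<in> {1..L}" for l
    using that unfolding assms(4) by (intro Min_le) auto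
  \<comment> \<open>At least two colours, each occurring at least \<open>\<kappa>_min\<close> times,
    give \<open>y \<ge> 2\<close> and thus \<open>ln y \<ge> ln 2\<close>.\<close>
  have "2 * \<kappa>_min \<le> L * \<kappa>_min" using assms(1) by simp
  also have "\<dots> \<le> n"
    using sum_bounded_below[of "{1..L}" \<kappa>_min \<kappa>] min_le unfolding assms(3) by simp
  finally have n2: "2 * \<kappa>_min \<le> n" .
  then have npos: "n > 0" using minpos by simp
  have y2: "y \<ge> 2" using n2 minpos unfolding y_def by (simp add: pos_le_divide_eq of_nat_mono flip: of_nat_mult)
  have lny: "ln y \<ge> ln 2" "ln y > 0" using y2 by simp_all
  obtain u where u: "u \<in> Om" using multislice_nonempty unfolding Om_def by blast
  have Om_eq: "Om = rearrangements S x" if "x \<in> Om" for x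
    using multislice_eq_rearrangements that unfolding Om_def S_def assms(3) .
  have cnt: "card {i \<in> S. x i = l} = \<kappa> l" if "x \<in> Om" "l \<in> {1..L}" for x l
    using that unfolding Om_def S_def multislice_def assms(3) by simp
  have ex: "\<exists>i\<in>S. u i = l" if "l \<in> {1..L}" for l
  proof (rule ccontr)
    assume "\<not> (\<exists>i\<in>S. u i = l)"
    then have "{i \<in> S. u i = l} = {}" by auto
    then have "\<kappa> l = 0" using cnt[OF u that] by (simp only: card.empty)
    then show False using assms(2)[rule_format, OF that] by simp
  qed
  have swap: "u \<circ> transpose i j \<in> Om" if "i \<in> S" "j \<in> S" for i j
    using comp_transpose_in_rearrangements[OF rearrangements_refl that] unfolding Om_eq[OF u] .
  have "card Om \<ge> 2"
  proof -
    \<comment> \<open>Swapping a coordinate of colour 1 with one of colour 2 gives a second point,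
      so the maximum defining \<open>iota\<close> is attained.\<close>
    obtain i j where ij: "i \<in> S" "u i = 1" "j \<in> S" "u j = 2"
      using ex[of 1] ex[of 2] assms(1) by auto
    have "(u \<circ> transpose i j) i \<noteq> u i" using ij by simp
    then have "u \<circ> transpose i j \<noteq> u" by metis
    then have "card {u, u \<circ> transpose i j} = 2" by simp
    moreover have "{u, u \<circ> transpose i j} \<subseteq> Om" using u swap[OF ij(1,3)] by blast
    ultimately show ?thesis using card_mono[OF finOm] by metis
  qed
  note iota = log_isoperimetric_bound_iota[of L \<kappa>, folded Om_def, OF this]

  \<comment> \<open>Lower bound on \<open>iota\<close>\<close>
  have "log_isoperimetric_bound L \<kappa> ((ln 2 / 4) * (real n / ln y))"
    unfolding log_isoperimetric_bound_def
  proof (intro allI impI, elim conjE)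
    fix A assume A: "A \<subseteq> multislice L \<kappa>" "A \<noteq> {}"
    define b where "b = real (card (edge_boundary (multislice_edges L \<kappa>) A))"
    define a where "a = real (card A)"
    define D where "D = ln (real (card Om) / a)"
    have "finite A" using A finOm finite_subset unfolding Om_def by blast
    then have apos: "a > 0" using A by (simp add: a_def card_gt_0_iff)
    have "real n * (a * D) \<le> (\<Sum>x\<in>A. \<Sum>i\<in>S. \<Sum>j\<in>S. of_bool (x \<circ> transpose i j \<notin> A)
          * (1 + ln (real n / real (card {k \<in> S. x k = x i}))))"
      using log_isoperimetric_rearrangements[OF finS _ A(2), of u] A(1)
      unfolding Om_eq[OF u, symmetric] cardS D_def a_def by (simp add: Om_def)
    \<comment> \<open>A rarest colour carries the largest weight, \<open>1 + ln y\<close>.\<close>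
    also have "\<dots> \<le> (\<Sum>x\<in>A. \<Sum>i\<in>S. \<Sum>j\<in>S. of_bool (x \<circ> transpose i j \<notin> A) * (1 + ln y))"
    proof (intro sum_mono mult_left_mono)
      fix x i assume xi: "x \<in> A" "i \<in> S"
      have x: "x \<in> Om" using xi A by (auto simp: Om_def)
      have "x i \<in> {1..L}" using x xi(2) unfolding Om_def multislice_def S_def assms(3) by auto
      then have card: "card {k \<in> S. x k = x i} = \<kappa> (x i)" "\<kappa>_min \<le> \<kappa> (x i)"
        using cnt[OF x] min_le by auto
      have "\<kappa> (x i) > 0" using card(2) minpos by linarith
      moreover have "real n / real (\<kappa> (x i)) \<le> y"
        unfolding y_def using card(2) minpos by (intro divide_left_mono) auto
      ultimately show "1 + ln (real n / real (card {k \<in> S. x k = x i})) \<le> 1 + ln y"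
        unfolding card(1) using npos y2 by simp
    qed simp
    also have "\<dots> = (\<Sum>x\<in>A. \<Sum>i\<in>S. \<Sum>j\<in>S. of_bool (x \<circ> transpose i j \<notin> A)) * (1 + ln y)"
      by (simp only: sum_distrib_right)
    also have "\<dots> \<le> (2 * b) * (1 + ln y)"
      using sum_swaps_le_edge_boundary[OF A(1)] lny unfolding b_def S_def assms(3)
      by (intro mult_right_mono) auto
    finally have main: "real n * (a * D) \<le> 2 * b * (1 + ln y)" .
    \<comment> \<open>Here \<open>ln 2 \<le> ln y\<close> and \<open>ln 2 \<le> 1\<close> are used.
      Together with the factor 2 from ordered pairs this produces the constant
      \<open>ln 2 / 4\<close>.\<close>
    have "ln 2 * (1 + ln y) \<le> 2 * ln y"
    proof -
      have "ln 2 * ln y \<le> 1 * ln y" using lny ln_le_minus_one[of 2] by (intro mult_right_mono) auto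
      then show ?thesis using lny unfolding distrib_left mult_1_right mult_1_left by linarith
    qed
    then have "b * (ln 2 * (1 + ln y)) \<le> b * (2 * ln y)"
      by (intro mult_left_mono) (simp_all add: b_def)
    moreover have "ln 2 * (real n * (a * D)) \<le> ln 2 * (2 * b * (1 + ln y))"
      using main by (intro mult_left_mono) auto
    ultimately have "ln 2 * (real n * (a * D)) \<le> 4 * b * ln y"
      by (simp add: algebra_simps)
    then have "ln 2 / 4 * (real n / ln y) * D \<le> b / a"
      using apos lny by (simp add: field_simps)
    then show "real (card (edge_boundary (multislice_edges L \<kappa>) A)) / real (card A)
        \<ge> (ln 2 / 4) * (real n / ln y) * ln (real (card (multislice L \<kappa>)) / real (card A))"
      by (simp add: b_def a_def D_def Om_def)
  qed
  then show "(ln 2 / 4) * (real n / ln (real n / real \<kappa>_min)) \<le> iota L \<kappa>"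
    unfolding y_def by (rule iota(2))

  \<comment> \<open>Upper bound on \<open>iota\<close>\<close>
  define A where "A = {x \<in> multislice L \<kappa>. x 1 = m}"
  have oneS: "1 \<in> S" using npos by (simp add: S_def)
  obtain i where i: "i \<in> S" "u i = m" using ex[OF m(1)] by blast
  have "u \<circ> transpose 1 i \<in> A"
    using swap[OF oneS i(1)] i(2) by (simp add: A_def Om_def)
  then have Ane: "A \<noteq> {}" by blast
  have "finite A" using finOm by (simp add: A_def Om_def)
  then have apos: "real (card A) > 0" using Ane by (simp add: card_gt_0_iff)
  \<comment> \<open>By symmetry of the coordinates the density of \<open>A\<close> is exactly
    \<open>\<kappa>_min / n\<close>, so the logarithm in the isoperimetric inequality equals
    \<open>ln y\<close>.\<close>
  have "real n * real (card A) = real \<kappa>_min * real (card Om)"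
    using card_coordinate[OF finS oneS, of u m] unfolding cardS cnt[OF u m(1)] m(2)
    unfolding Om_eq[OF u, symmetric] by (simp add: A_def Om_def)
  then have ratio: "real (card Om) / real (card A) = y"
    using apos minpos by (simp add: y_def field_simps)
  have "iota L \<kappa> * ln y
      \<le> real (card (edge_boundary (multislice_edges L \<kappa>) A)) / real (card A)"
    using iota(1) Ane unfolding log_isoperimetric_bound_def ratio[symmetric] Om_def
    by (auto simp: A_def)
  also have "\<dots> \<le> real n"
  proof -
    have "card (edge_boundary (multislice_edges L \<kappa>) A) \<le> card A * n"
      using card_edge_boundary_coordinate_le[where i = 1] oneS
      unfolding A_def assms(3) S_def by blast
    then have "real (card (edge_boundary (multislice_edges L \<kappa>) A)) \<le> real n * real (card A)"
      by (metis mult.commute of_nat_mono of_nat_mult)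
    then show ?thesis using apos by (simp add: pos_divide_le_eq)
  qed
  finally show "iota L \<kappa> \<le> real n / ln (real n / real \<kappa>_min)"
    using lny by (simp add: pos_le_divide_eq flip: y_def)
qed

end
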